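(* For every non-negative integer $k$ there exists a Boolean function $f:\{0,1\}^n\to\{0,1\}$ on $n=(2k+1)^2$ variables such that $s(f)=2k+1$ and $bs(f)=(2k+1)(k+1)$.
   Context: For $w\in\{0,1\}^n$ and $S\subseteq\{1,\dots,n\}$, $w^S$ denotes $w$ with all bits indexed by $S$ flipped. The sensitivity of $f$ on $w$ is $s(f,w)=|\{i: f(w)\neq f(w^{\{i\}})\}|$, and $s(f)=\max_w s(f,w)$. The block sensitivity $bs(f,w)$ is the maximum number $k$ of pairwise disjoint subsets $B_1,\dots,B_k$ of $\{1,\dots,n\}$ such that $f(w)\neq f(w^{B_i})$ for each $i$, and $bs(f)=\max_w bs(f,w)$. *)

theory Defs
  imports Main "HOL-Library.FuncSet" "HOL-Library.Disjoint_Sets"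
begin

text \<open>
  The cube of words of length \<open>n\<close>, with bits indexed by \<open>{1..n}\<close>. Words are extensional, so that
  equality of words is equality of their \<open>n\<close> bits.
\<close>

definition cube :: "nat \<Rightarrow> (nat \<Rightarrow> bool) set" where
  "cube n = {1..n} \<rightarrow>\<^sub>E UNIV"

definition boolean_functions :: "nat \<Rightarrow> ((nat \<Rightarrow> bool) \<Rightarrow> bool) set" where
  "boolean_functions n = cube n \<rightarrow>\<^sub>E UNIV"

definition flip :: "(nat \<Rightarrow> bool) \<Rightarrow> nat set \<Rightarrow> nat \<Rightarrow> bool" where
  "flip w S = (\<lambda>i. if i \<in> S then \<not> w i else w i)"

definition sensitivity_at :: "nat \<Rightarrow> ((nat \<Rightarrow> bool) \<Rightarrow> bool) \<Rightarrow> (nat \<Rightarrow> bool) \<Rightarrow> nat" where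
  "sensitivity_at n f w = card {i \<in> {1..n}. f w \<noteq> f (flip w {i})}"

definition sensitivity :: "nat \<Rightarrow> ((nat \<Rightarrow> bool) \<Rightarrow> bool) \<Rightarrow> nat" where
  "sensitivity n f = Max (sensitivity_at n f ` cube n)"

definition sensitive_blocks ::
  "nat \<Rightarrow> ((nat \<Rightarrow> bool) \<Rightarrow> bool) \<Rightarrow> (nat \<Rightarrow> bool) \<Rightarrow> nat \<Rightarrow> (nat \<Rightarrow> nat set) \<Rightarrow> bool" where
  "sensitive_blocks n f w k B \<longleftrightarrow>
     disjoint_family_on B {1..k} \<and>
     (\<forall>i\<in>{1..k}. B i \<subseteq> {1..n} \<and> f w \<noteq> f (flip w (B i)))"

definition block_sensitivity_at :: "nat \<Rightarrow> ((nat \<Rightarrow> bool) \<Rightarrow> bool) \<Rightarrow> (nat \<Rightarrow> bool) \<Rightarrow> nat" where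
  "block_sensitivity_at n f w = Max {k. \<exists>B. sensitive_blocks n f w k B}"

definition block_sensitivity :: "nat \<Rightarrow> ((nat \<Rightarrow> bool) \<Rightarrow> bool) \<Rightarrow> nat" where
  "block_sensitivity n f = Max (block_sensitivity_at n f ` cube n)"

text \<open>All three maxima are taken over finite nonempty sets.\<close>

lemma finite_cube: "finite (cube n)"
  unfolding cube_def by (intro finite_PiE) auto

lemma cube_nonempty: "cube n \<noteq> {}"
  unfolding cube_def by (simp add: PiE_eq_empty_iff)

lemma flip_in_cube: "w \<in> cube n \<Longrightarrow> S \<subseteq> {1..n} \<Longrightarrow> flip w S \<in> cube n"
  unfolding cube_def flip_def by (auto simp: PiE_iff extensional_def)

lemma sensitive_blocks_le:
  assumes "sensitive_blocks n f w k B"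
  shows "k \<le> n"
proof -
  have disj: "disjoint_family_on B {1..k}" and sub: "\<And>i. i \<in> {1..k} \<Longrightarrow> B i \<subseteq> {1..n}"
    and sens: "\<And>i. i \<in> {1..k} \<Longrightarrow> f w \<noteq> f (flip w (B i))"
    using assms unfolding sensitive_blocks_def by blast+
  have "flip w {} = w" by (simp add: flip_def)
  then have ne: "B i \<noteq> {}" if "i \<in> {1..k}" for i
    using sens[OF that] by metis
  have fin: "finite (B i)" if "i \<in> {1..k}" for i
    using sub[OF that] finite_subset by blast
  have "k = (\<Sum>i\<in>{1..k}. 1)" by simp
  also have "\<dots> \<le> (\<Sum>i\<in>{1..k}. card (B i))"
    using ne fin by (intro sum_mono) (simp add: Suc_le_eq card_gt_0_iff)
  also have "\<dots> = card (\<Union>i\<in>{1..k}. B i)"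
    using disj fin by (intro card_UN_disjoint[symmetric]) (auto simp: disjoint_family_on_def)
  also have "\<dots> \<le> card {1..n}"
    using sub by (intro card_mono UN_least) simp_all
  finally show ?thesis by simp
qed

lemma finite_sensitive_blocks: "finite {k. \<exists>B. sensitive_blocks n f w k B}"
  by (rule finite_subset[of _ "{..n}"]) (auto dest: sensitive_blocks_le)

lemma sensitive_blocks_nonempty: "{k. \<exists>B. sensitive_blocks n f w k B} \<noteq> {}"
  by (auto simp: sensitive_blocks_def disjoint_family_on_def intro!: exI[of _ 0])

end

theory Submission
  imports Defs
begin

text \<open>
  Virza's function: arrange the \<open>(2k+1)\<^sup>2\<close> variables in \<open>2k+1\<close> sections of \<open>2k+1\<close> variables, and cut
  each section into \<open>k\<close> pairs and one singleton. The function accepts a word iff in some section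
  the true bits are exactly one of these \<open>k+1\<close> pieces. Any two pieces of a section differ in at
  least three positions, so a rejected word has at most one sensitive bit per section; the sensitive
  bits of an accepted word all lie in one section. Hence the sensitivity is at most \<open>2k+1\<close>. All
  \<open>(2k+1)(k+1)\<close> pieces are sensitive blocks of the zero word. The remaining two bounds follow from
  \<open>2 bs(f) \<le> n + s(f)\<close>, which holds since blocks with one element are sensitive bits and all others
  take up at least two variables.
\<close>

section \<open>Bounds valid for every Boolean function\<close>

lemma sensitivity_at_le: "w \<in> cube n \<Longrightarrow> sensitivity_at n f w \<le> sensitivity n f"
  unfolding sensitivity_def by (intro Max_ge) (auto simp: finite_cube)

lemma sensitivity_leI:
  assumes "\<And>w. w \<in> cube n \<Longrightarrow> sensitivity_at n f w \<le> b"
  shows "sensitivity n f \<le> b"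
  unfolding sensitivity_def using assms by (subst Max_le_iff) (auto simp: finite_cube cube_nonempty)

lemma sensitive_blocks_le_block_sensitivity:
  assumes "w \<in> cube n" and "sensitive_blocks n f w b B"
  shows "b \<le> block_sensitivity n f"
proof -
  have "b \<le> block_sensitivity_at n f w"
    unfolding block_sensitivity_at_def using assms(2) finite_sensitive_blocks
    by (intro Max_ge) auto
  also have "\<dots> \<le> block_sensitivity n f"
    unfolding block_sensitivity_def using assms(1) by (intro Max_ge) (auto simp: finite_cube)
  finally show ?thesis .
qed

lemma block_sensitivity_attained:
  obtains w B where "w \<in> cube n" and "sensitive_blocks n f w (block_sensitivity n f) B"
proof -
  have "block_sensitivity n f \<in> block_sensitivity_at n f ` cube n"
    unfolding block_sensitivity_def by (intro Max_in) (auto simp: finite_cube cube_nonempty)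
  then obtain w where w: "w \<in> cube n" "block_sensitivity n f = block_sensitivity_at n f w"
    by auto
  moreover have "block_sensitivity_at n f w \<in> {k. \<exists>B. sensitive_blocks n f w k B}"
    unfolding block_sensitivity_at_def
    using finite_sensitive_blocks sensitive_blocks_nonempty by (rule Max_in)
  ultimately show thesis using that by auto
qed

lemma sensitive_blocks_bound:
  assumes "sensitive_blocks n f w b B"
  shows "2 * b \<le> n + sensitivity_at n f w"
proof -
  have disj: "disjoint_family_on B {1..b}" and sub: "\<And>i. i \<in> {1..b} \<Longrightarrow> B i \<subseteq> {1..n}"
    and sens: "\<And>i. i \<in> {1..b} \<Longrightarrow> f w \<noteq> f (flip w (B i))"
    using assms unfolding sensitive_blocks_def by blast+
  have "flip w {} = w" by (simp add: flip_def)
  then have ne: "B i \<noteq> {}" if "i \<in> {1..b}" for i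
    using sens[OF that] by metis
  have fin: "finite (B i)" if "i \<in> {1..b}" for i
    using sub[OF that] finite_subset by blast
  define A where "A = {i \<in> {1..b}. card (B i) = 1}"
  have "2 * b = (\<Sum>i\<in>{1..b}. 2)" by simp
  \<comment> \<open>Sensitive blocks are nonempty, so one extra unit for each singleton raises every
    summand to at least 2. The sizes sum to at most \<open>n\<close>, and the extra units count
    distinct sensitive bits.\<close>
  also have "\<dots> \<le> (\<Sum>i\<in>{1..b}. card (B i) + of_bool (card (B i) = 1))"
  proof (rule sum_mono)
    fix i assume "i \<in> {1..b}"
    then have "card (B i) > 0" using ne fin by (simp add: card_gt_0_iff)
    then show "2 \<le> card (B i) + of_bool (card (B i) = 1)" by (auto simp: of_bool_def)
  qed
  also have "\<dots> = (\<Sum>i\<in>{1..b}. card (B i)) + card A"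
    by (simp add: sum.distrib A_def Int_def)
  also have "(\<Sum>i\<in>{1..b}. card (B i)) = card (\<Union>i\<in>{1..b}. B i)"
    using disj fin by (intro card_UN_disjoint[symmetric]) (auto simp: disjoint_family_on_def)
  also have "\<dots> \<le> card {1..n}"
    using sub by (intro card_mono UN_least) simp_all
  also have "card A = (\<Sum>i\<in>A. card (B i))" by (simp add: A_def)
  also have "\<dots> = card (\<Union>i\<in>A. B i)"
    using disj fin
    by (intro card_UN_disjoint[symmetric]) (auto simp: disjoint_family_on_def A_def)
  also have "\<dots> \<le> sensitivity_at n f w"
    unfolding sensitivity_at_def
  proof (intro card_mono UN_least subsetI)
    fix i x assume i: "i \<in> A" and x: "x \<in> B i"
    then have "B i = {x}" by (auto simp: A_def card_1_singleton_iff)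
    then show "x \<in> {i \<in> {1..n}. f w \<noteq> f (flip w {i})}"
      using i x sens[of i] sub[of i] by (auto simp: A_def)
  qed simp
  finally show ?thesis by simp
qed

lemma block_sensitivity_bound: "2 * block_sensitivity n f \<le> n + sensitivity n f"
proof -
  obtain w B where "w \<in> cube n" "sensitive_blocks n f w (block_sensitivity n f) B"
    by (rule block_sensitivity_attained)
  then show ?thesis
    using sensitive_blocks_bound sensitivity_at_le by (meson add_left_mono order_trans)
qed

section \<open>Virza's function and its sensitivity\<close>

text \<open>Variables are numbered from \<open>1\<close>, sections and the pieces in each of them from \<open>0\<close>.\<close>

definition sec :: "nat \<Rightarrow> nat \<Rightarrow> nat" where
  "sec k i = (i - 1) div (2 * k + 1)"

text \<open>Halving the offsets \<open>0\<close>, ..., \<open>2 * k\<close> inside a section gives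
  pairs for the values below \<open>k\<close>; only the last offset \<open>2 * k\<close> has value
  \<open>k\<close>, which is the singleton.\<close>

definition piece :: "nat \<Rightarrow> nat \<Rightarrow> nat" where
  "piece k i = (i - 1) mod (2 * k + 1) div 2"

definition section_vars :: "nat \<Rightarrow> nat \<Rightarrow> nat set" where
  "section_vars k r = {i \<in> {1..(2 * k + 1)\<^sup>2}. sec k i = r}"

definition virza :: "nat \<Rightarrow> (nat \<Rightarrow> bool) \<Rightarrow> bool" where
  "virza k w \<longleftrightarrow> (\<exists>r<2 * k + 1. \<exists>j\<le>k. \<forall>i\<in>section_vars k r. w i \<longleftrightarrow> piece k i = j)"

lemma sec_less: "i \<in> {1..(2 * k + 1)\<^sup>2} \<Longrightarrow> sec k i < 2 * k + 1"
  unfolding sec_def by (intro less_mult_imp_div_less) (auto simp: power2_eq_square)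

lemma position_in_section:
  assumes "r < 2 * k + 1" and "d < 2 * k + 1"
  shows "(2 * k + 1) * r + d + 1 \<in> section_vars k r"
    and "piece k ((2 * k + 1) * r + d + 1) = d div 2"
proof -
  let ?m = "2 * k + 1"
  have "?m * r + d + 1 \<le> ?m * (r + 1)"
    using assms(2) unfolding add_mult_distrib2 mult_1_right by linarith
  also have "\<dots> \<le> ?m\<^sup>2"
    unfolding power2_eq_square using assms(1) by (intro mult_le_mono2) linarith
  finally have "?m * r + d + 1 \<le> ?m\<^sup>2" .
  moreover have "(?m * r + d) div ?m = r" "(?m * r + d) mod ?m = d"
    using assms(2) by (simp_all only: div_mult_self4 mod_mult_self4 div_less mod_less)
  ultimately show "?m * r + d + 1 \<in> section_vars k r" "piece k (?m * r + d + 1) = d div 2"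
    unfolding section_vars_def sec_def piece_def by simp_all
qed

lemma card_section_vars: "card (section_vars k r) \<le> 2 * k + 1"
proof -
  let ?m = "2 * k + 1"
  have "section_vars k r \<subseteq> (\<lambda>d. ?m * r + d + 1) ` {..<?m}"
  proof
    fix i assume i: "i \<in> section_vars k r"
    then have "i = ?m * r + (i - 1) mod ?m + 1"
      using mult_div_mod_eq[of ?m "i - 1"] unfolding section_vars_def sec_def by auto
    then show "i \<in> (\<lambda>d. ?m * r + d + 1) ` {..<?m}"
      by (intro image_eqI[of _ _ "(i - 1) mod ?m"]) auto
  qed
  from surj_card_le[OF _ this] show ?thesis by simp
qed

text \<open>As \<open>j < j'\<close>, piece \<open>j\<close> is a pair; with one element of piece
  \<open>j'\<close> this gives three variables that tell the pieces apart, and \<open>x\<close>,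
  \<open>y\<close> can account for only two of them. In the application \<open>x\<close> and
  \<open>y\<close> are two flipped bits.\<close>

lemma pieces_differ:
  assumes r: "r < 2 * k + 1" and "j < j'" and "j' \<le> k"
    and eq: "\<And>i. i \<in> section_vars k r \<Longrightarrow> i \<noteq> x \<Longrightarrow> i \<noteq> y \<Longrightarrow> piece k i = j \<longleftrightarrow> piece k i = j'"
  shows False
proof -
  let ?p = "\<lambda>d. (2 * k + 1) * r + d + 1"
  \<comment> \<open>Offset \<open>2 * j'\<close> lies in the section even when \<open>j' = k\<close>
    and that piece is the singleton.\<close>
  have *: "?p d = x \<or> ?p d = y" if "d \<in> {2 * j, 2 * j + 1, 2 * j'}" for d
  proof (rule ccontr)
    assume "\<not> (?p d = x \<or> ?p d = y)"
    moreover have d: "d < 2 * k + 1" using that assms by auto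
    ultimately have "d div 2 = j \<longleftrightarrow> d div 2 = j'"
      using eq[of "?p d"] position_in_section[OF r d] by metis
    then show False using that \<open>j < j'\<close> by auto
  qed
  show False
    using *[of "2 * j"] *[of "2 * j + 1"] *[of "2 * j'"] \<open>j < j'\<close>
    by auto presburger+
qed

lemma virza_flip_outside:
  assumes "i \<notin> section_vars k r"
  shows "(\<forall>p\<in>section_vars k r. flip w {i} p \<longleftrightarrow> piece k p = j) \<longleftrightarrow>
    (\<forall>p\<in>section_vars k r. w p \<longleftrightarrow> piece k p = j)"
  using assms by (auto simp: flip_def)

lemma card_sensitive_virza:
  "card {i \<in> {1..(2 * k + 1)\<^sup>2}. virza k w \<noteq> virza k (flip w {i})} \<le> 2 * k + 1"
    (is "card ?S \<le> _")
proof (cases "virza k w")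
  case True
  then obtain r j where r: "r < 2 * k + 1" "j \<le> k"
    and w: "\<forall>p\<in>section_vars k r. w p \<longleftrightarrow> piece k p = j"
    unfolding virza_def by blast
  have "?S \<subseteq> section_vars k r"
  proof (rule subsetI, rule ccontr)
    fix i assume i: "i \<in> ?S" "i \<notin> section_vars k r"
    then have "virza k (flip w {i})"
      using virza_flip_outside[of i k r w j] w r unfolding virza_def by blast
    with True i show False by simp
  qed
  then have "card ?S \<le> card (section_vars k r)"
    by (intro card_mono) (auto simp: section_vars_def)
  then show ?thesis using card_section_vars[of k r] by linarith
next
  case False
  \<comment> \<open>A flip leaves all other sections as they were, and none of them was accepting,
    so acceptance must arise in the section of the flipped bit.\<close>
  have accept: "\<exists>j\<le>k. \<forall>p\<in>section_vars k (sec k i). flip w {i} p \<longleftrightarrow> piece k p = j"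
    if "i \<in> ?S" for i
  proof -
    from that False obtain r j where r: "r < 2 * k + 1" "j \<le> k"
      and w: "\<forall>p\<in>section_vars k r. flip w {i} p \<longleftrightarrow> piece k p = j"
      unfolding virza_def by blast
    have "i \<in> section_vars k r"
    proof (rule ccontr)
      assume "i \<notin> section_vars k r"
      from virza_flip_outside[OF this, of w j] have "virza k w"
        using w r unfolding virza_def by blast
      with False show False by simp
    qed
    then have "sec k i = r" by (simp add: section_vars_def)
    with r w show ?thesis by blast
  qed
  \<comment> \<open>At most one sensitive bit per section, so the number of sections bounds their
    number.\<close>
  have "inj_on (sec k) ?S"
  proof (rule inj_onI, rule ccontr)
    fix x y assume x: "x \<in> ?S" and y: "y \<in> ?S" and eq: "sec k x = sec k y" and ne: "x \<noteq> y"
    define r where "r = sec k x"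
    have r: "r < 2 * k + 1" "y \<in> section_vars k r"
      using x y eq sec_less by (auto simp: r_def section_vars_def)
    obtain j where j: "j \<le> k" "\<forall>p\<in>section_vars k r. flip w {x} p \<longleftrightarrow> piece k p = j"
      using accept[OF x] r_def by auto
    obtain j' where j': "j' \<le> k" "\<forall>p\<in>section_vars k r. flip w {y} p \<longleftrightarrow> piece k p = j'"
      using accept[OF y] r_def eq by auto
    have *: "piece k i = j \<longleftrightarrow> piece k i = j'" if "i \<in> section_vars k r" "i \<noteq> x" "i \<noteq> y" for i
      using that j(2)[rule_format, of i] j'(2)[rule_format, of i] by (simp add: flip_def)
    \<comment> \<open>Variable \<open>y\<close> has opposite values in the two flipped words, so
      they cannot match the same piece.\<close>
    have "j \<noteq> j'"
      using j(2)[rule_format, OF r(2)] j'(2)[rule_format, OF r(2)] ne by (auto simp: flip_def)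
    then consider "j < j'" | "j' < j" by linarith
    then show False
      using pieces_differ[OF r(1), of j j' x y] pieces_differ[OF r(1), of j' j x y] j(1) j'(1) *
      by cases blast+
  qed
  moreover have "sec k ` ?S \<subseteq> {..<2 * k + 1}"
    using sec_less by auto
  ultimately show ?thesis
    using card_inj_on_le[of "sec k" ?S "{..<2 * k + 1}"] by simp
qed

text \<open>Every piece is nonempty, as it contains offset \<open>2 * j\<close>, so acceptance
  requires some true bit.\<close>

lemma not_virza_zero:
  assumes "\<And>i. i \<in> {1..(2 * k + 1)\<^sup>2} \<Longrightarrow> \<not> w i"
  shows "\<not> virza k w"
proof
  assume "virza k w"
  then obtain r j where r: "r < 2 * k + 1" "j \<le> k"
    and w: "\<forall>p\<in>section_vars k r. w p \<longleftrightarrow> piece k p = j"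
    unfolding virza_def by blast
  from r(2) have d: "2 * j < 2 * k + 1" by simp
  show False
    using position_in_section[OF r(1) d] w assms by (auto simp: section_vars_def)
qed

theorem theorem2:
  fixes k :: nat
  shows "\<exists>f \<in> boolean_functions ((2 * k + 1)^2).
           sensitivity ((2 * k + 1)^2) f = 2 * k + 1 \<and>
           block_sensitivity ((2 * k + 1)^2) f = (2 * k + 1) * (k + 1)"
proof -
  define n where "n = (2 * k + 1)\<^sup>2"
  define f where "f = restrict (virza k) (cube n)"
  define z where "z = (\<lambda>i\<in>{1..n}. False)"
  \<comment> \<open>Division with remainder by \<open>k + 1\<close> decodes \<open>t - 1\<close>
    into a section and a piece; the shift is there because blocks are indexed from 1.\<close>
  define B where "B t = {i \<in> {1..n}. sec k i = (t - 1) div (k + 1) \<and> piece k i = (t - 1) mod (k + 1)}"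
    for t
  have z: "z \<in> cube n" by (auto simp: z_def cube_def)
  have f: "f \<in> boolean_functions n" by (simp add: f_def boolean_functions_def)
  have f_flip: "f (flip w S) = virza k (flip w S)" if "w \<in> cube n" "S \<subseteq> {1..n}" for w S
    using flip_in_cube[OF that] by (simp add: f_def)
  have "sensitivity n f \<le> 2 * k + 1"
  proof (rule sensitivity_leI)
    fix w assume w: "w \<in> cube n"
    then have "{i \<in> {1..n}. f w \<noteq> f (flip w {i})}
        = {i \<in> {1..n}. virza k w \<noteq> virza k (flip w {i})}"
      by (intro Collect_cong conj_cong refl) (simp add: f_flip, simp add: f_def)
    then show "sensitivity_at n f w \<le> 2 * k + 1"
      unfolding sensitivity_at_def using card_sensitive_virza[of k w] by (simp add: n_def)
  qed
  moreover have "(2 * k + 1) * (k + 1) \<le> block_sensitivity n f"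
  proof (rule sensitive_blocks_le_block_sensitivity[OF z])
    show "sensitive_blocks n f z ((2 * k + 1) * (k + 1)) B"
      unfolding sensitive_blocks_def disjoint_family_on_def
    proof (intro conjI ballI impI)
      fix s t assume st: "s \<in> {1..(2 * k + 1) * (k + 1)}" "t \<in> {1..(2 * k + 1) * (k + 1)}" "s \<noteq> t"
      then have "s - 1 \<noteq> t - 1" by auto
      then have "(s - 1) div (k + 1) \<noteq> (t - 1) div (k + 1) \<or> (s - 1) mod (k + 1) \<noteq> (t - 1) mod (k + 1)"
        by (metis div_mult_mod_eq)
      then show "B s \<inter> B t = {}" unfolding B_def by auto
    next
      fix t assume t: "t \<in> {1..(2 * k + 1) * (k + 1)}"
      show sub: "B t \<subseteq> {1..n}" by (auto simp: B_def)
      have "(t - 1) div (k + 1) < 2 * k + 1"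
        using t by (intro less_mult_imp_div_less) auto
      moreover have "(t - 1) mod (k + 1) \<le> k"
        using mod_less_divisor[of "k + 1" "t - 1"] by linarith
      moreover have "\<forall>i\<in>section_vars k ((t - 1) div (k + 1)).
          flip z (B t) i \<longleftrightarrow> piece k i = (t - 1) mod (k + 1)"
        by (auto simp: section_vars_def flip_def B_def z_def n_def)
      ultimately have "virza k (flip z (B t))" unfolding virza_def by blast
      moreover have "\<not> virza k z"
        by (rule not_virza_zero) (simp add: z_def n_def)
      ultimately show "f z \<noteq> f (flip z (B t))"
        using f_flip[OF z sub] z by (simp add: f_def)
    qed
  qed
  moreover have "2 * block_sensitivity n f \<le> n + sensitivity n f"
    by (rule block_sensitivity_bound)
  \<comment> \<open>With this identity the three preceding inequalities close into a cycle, so each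
    of them is an equality.\<close>
  moreover have "n + (2 * k + 1) = 2 * ((2 * k + 1) * (k + 1))"
    by (simp add: n_def power2_eq_square algebra_simps)
  ultimately have "sensitivity n f = 2 * k + 1 \<and> block_sensitivity n f = (2 * k + 1) * (k + 1)"
    by linarith
  with f show ?thesis unfolding n_def by blast
qed

end
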